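(* Let $\gamma>1$, $k_1,k_2,k_3>-1$ and $k=\frac{(1+k_1)(1+k_3)}{(1+k_2)^2}-1$. Let $U_+$ be a state with $\rho_+>0$, $p_+>0$, $u_+>0$ and Mach number $M_+$. Let $\mathcal{D}^B(U_+,k_1,k_2,k_3)$ be the set of all left-hand states $U_-$ that can be connected to $U_+$ (as right-hand state) by a stationary wave with coefficients $k_1,k_2,k_3$ satisfying the Monotonicity Criterion. Set $$I^B=\frac{\sqrt{(\gamma M_+^2+1)^2-(\gamma+1)M_+^2[(\gamma-1)M_+^2+2]/(1+k)}}{\gamma M_+^2+1}.$$ Then $\mathcal{D}^B(U_+,k_1,k_2,k_3)$ consists exactly of the states $U_-$ whose Mach number $M_-$ is given by (each line applying when its condition on $M_+$ holds; if two lines of a case apply, both values are allowed; if none applies, the set is empty): if $k>0$: $M_-=\sqrt{\frac{1-I^B}{1+\gamma I^B}}$ for $0<M_+\le 1$, and $M_-=\sqrt{\frac{1+I^B}{1-\gamma I^B}}$ for $1\le M_+<M_3^*$; if $k<0$: $M_-=\sqrt{\frac{1-I^B}{1+\gamma I^B}}$ for $0<M_+\le M_1^{**}$, and $M_-=\sqrt{\frac{1+I^B}{1-\gamma I^B}}$ for $M_2^{**}\le M_+<+\infty$; if $k=0$: $M_-=\sqrt{\frac{1-I^B}{1+\gamma I^B}}$ for $0<M_+\le 1$, and $M_-=\sqrt{\frac{1+I^B}{1-\gamma I^B}}$ for $1<M_+<+\infty$; and whose density, velocity and pressure are $$\rho_-=\rho_+\Big(\frac{M_+}{M_-}\Big)^2\frac{\gamma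 M_-^2+1}{\gamma M_+^2+1}\frac{1+k_2}{(1+k_1)^2},\quad u_-=u_+\Big(\frac{M_-}{M_+}\Big)^2\frac{\gamma M_+^2+1}{\gamma M_-^2+1}\frac{1+k_1}{1+k_2},\quad p_-=p_+\frac{\gamma M_+^2+1}{\gamma M_-^2+1}\frac{1}{1+k_2}.$$
   Context: States are $U=(\rho,\rho u,E)$ with $\rho>0$, $p>0$, $E=\frac{p}{\gamma-1}+\frac12\rho u^2$; sound speed $a=\sqrt{\gamma p/\rho}$; Mach number $M=u/a$; $\lambda_1=u-a$, $\lambda_2=u$, $\lambda_3=u+a$. Subscripts refer to the corresponding state. A stationary wave with coefficients $k_1,k_2,k_3$, left-hand state $U_-$ and right-hand state $U_+$ (with positive velocities) is a pair satisfying the jump relation $\rho_-u_-(1+k_1)=\rho_+u_+$, $(\rho_-u_-^2+p_-)(1+k_2)=\rho_+u_+^2+p_+$, $(E_-+p_-)u_-(1+k_3)=(E_++p_+)u_+$. Monotonicity Criterion: $\lambda_j(U_-)\lambda_j(U_+)\ge 0$ for $j=1,2,3$. Critical Mach numbers. For $k>0$: $M_3^*=\sqrt{\frac{\gamma+\sqrt{1-k(\gamma^2-1)}}{\gamma-\gamma\sqrt{1-k(\gamma^2-1)}}}$ if $0<k<\frac1{\gamma^2-1}$, and $M_3^*=1$ if $k\ge\frac1{\gamma^2-1}$. For $-1<k<0$: $M_1^{**}=\sqrt{\frac{1-\sqrt{-k}}{1+\gamma\sqrt{-k}}}$; $M_2^{**}=\sqrt{\frac{1+\sqrt{-k}}{1-\gamma\sqrt{-k}}}$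 if $-\frac1{\gamma^2}<k<0$, and $M_2^{**}=+\infty$ if $-1<k\le-\frac1{\gamma^2}$. *)

theory Defs
  imports Complex_Main "HOL-Library.Extended_Real"
begin

datatype euler_state = Euler_State (density: real) (momentum: real) (energy: real)

definition velocity :: "euler_state \<Rightarrow> real" where
  "velocity U = momentum U / density U"

(* The equation of state E = p/(gamma-1) + rho u^2/2 solved for p; see energy_eq. *)
definition pressure :: "real \<Rightarrow> euler_state \<Rightarrow> real" where
  "pressure \<gamma> U = (\<gamma> - 1) * (energy U - 1/2 * density U * (velocity U)\<^sup>2)"

lemma energy_eq:
  "\<gamma> \<noteq> 1 \<Longrightarrow> energy U = pressure \<gamma> U / (\<gamma> - 1) + 1/2 * density U * (velocity U)\<^sup>2"
  by (simp add: pressure_def)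

lemma momentum_eq: "density U \<noteq> 0 \<Longrightarrow> momentum U = density U * velocity U"
  by (simp add: velocity_def)

definition is_state :: "real \<Rightarrow> euler_state \<Rightarrow> bool" where
  "is_state \<gamma> U \<longleftrightarrow> density U > 0 \<and> pressure \<gamma> U > 0"

definition sound_speed :: "real \<Rightarrow> euler_state \<Rightarrow> real" where
  "sound_speed \<gamma> U = sqrt (\<gamma> * pressure \<gamma> U / density U)"

definition mach :: "real \<Rightarrow> euler_state \<Rightarrow> real" where
  "mach \<gamma> U = velocity U / sound_speed \<gamma> U"

definition lambda1 :: "real \<Rightarrow> euler_state \<Rightarrow> real" where
  "lambda1 \<gamma> U = velocity U - sound_speed \<gamma> U"

definition lambda2 :: "real \<Rightarrow> euler_state \<Rightarrow> real" where
  "lambda2 \<gamma> U = velocity U"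

definition lambda3 :: "real \<Rightarrow> euler_state \<Rightarrow> real" where
  "lambda3 \<gamma> U = velocity U + sound_speed \<gamma> U"

definition stationary_wave ::
  "real \<Rightarrow> real \<Rightarrow> real \<Rightarrow> real \<Rightarrow> euler_state \<Rightarrow> euler_state \<Rightarrow> bool" where
  "stationary_wave \<gamma> k1 k2 k3 Ul Ur \<longleftrightarrow>
     is_state \<gamma> Ul \<and> is_state \<gamma> Ur \<and> velocity Ul > 0 \<and> velocity Ur > 0 \<and>
     density Ul * velocity Ul * (1 + k1) = density Ur * velocity Ur \<and>
     (density Ul * (velocity Ul)\<^sup>2 + pressure \<gamma> Ul) * (1 + k2)
       = density Ur * (velocity Ur)\<^sup>2 + pressure \<gamma> Ur \<and>
     (energy Ul + pressure \<gamma> Ul) * velocity Ul * (1 + k3)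
       = (energy Ur + pressure \<gamma> Ur) * velocity Ur"

definition monotonicity_criterion :: "real \<Rightarrow> euler_state \<Rightarrow> euler_state \<Rightarrow> bool" where
  "monotonicity_criterion \<gamma> Ul Ur \<longleftrightarrow>
     lambda1 \<gamma> Ul * lambda1 \<gamma> Ur \<ge> 0 \<and>
     lambda2 \<gamma> Ul * lambda2 \<gamma> Ur \<ge> 0 \<and>
     lambda3 \<gamma> Ul * lambda3 \<gamma> Ur \<ge> 0"

definition DB :: "real \<Rightarrow> euler_state \<Rightarrow> real \<Rightarrow> real \<Rightarrow> real \<Rightarrow> euler_state set" where
  "DB \<gamma> Ur k1 k2 k3 =
     {Ul. stationary_wave \<gamma> k1 k2 k3 Ul Ur \<and> monotonicity_criterion \<gamma> Ul Ur}"

(* Meaningful for k > 0. *)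
definition M3_star :: "real \<Rightarrow> real \<Rightarrow> real" where
  "M3_star \<gamma> k =
     (if k < 1 / (\<gamma>\<^sup>2 - 1)
      then sqrt ((\<gamma> + sqrt (1 - k * (\<gamma>\<^sup>2 - 1))) / (\<gamma> - \<gamma> * sqrt (1 - k * (\<gamma>\<^sup>2 - 1))))
      else 1)"

(* M1_star2 and M2_star2 are meaningful for -1 < k < 0. *)
definition M1_star2 :: "real \<Rightarrow> real \<Rightarrow> real" where
  "M1_star2 \<gamma> k = sqrt ((1 - sqrt (- k)) / (1 + \<gamma> * sqrt (- k)))"

definition M2_star2 :: "real \<Rightarrow> real \<Rightarrow> ereal" where
  "M2_star2 \<gamma> k =
     (if - 1 / \<gamma>\<^sup>2 < k then ereal (sqrt ((1 + sqrt (- k)) / (1 - \<gamma> * sqrt (- k)))) else \<infinity>)"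

definition IB :: "real \<Rightarrow> real \<Rightarrow> real \<Rightarrow> real" where
  "IB \<gamma> k M =
     sqrt ((\<gamma> * M\<^sup>2 + 1)\<^sup>2 - (\<gamma> + 1) * M\<^sup>2 * ((\<gamma> - 1) * M\<^sup>2 + 2) / (1 + k)) / (\<gamma> * M\<^sup>2 + 1)"

definition mach_sub :: "real \<Rightarrow> real \<Rightarrow> real" where
  "mach_sub \<gamma> I = sqrt ((1 - I) / (1 + \<gamma> * I))"

definition mach_sup :: "real \<Rightarrow> real \<Rightarrow> real" where
  "mach_sup \<gamma> I = sqrt ((1 + I) / (1 - \<gamma> * I))"

definition left_mach_values :: "real \<Rightarrow> real \<Rightarrow> real \<Rightarrow> real set" where
  "left_mach_values \<gamma> k M =
     (if k > 0 then
        {m. 0 < M \<and> M \<le> 1 \<and> m = mach_sub \<gamma> (IB \<gamma> k M)} \<union>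
        {m. 1 \<le> M \<and> M < M3_star \<gamma> k \<and> m = mach_sup \<gamma> (IB \<gamma> k M)}
      else if k < 0 then
        {m. 0 < M \<and> M \<le> M1_star2 \<gamma> k \<and> m = mach_sub \<gamma> (IB \<gamma> k M)} \<union>
        {m. M2_star2 \<gamma> k \<le> ereal M \<and> m = mach_sup \<gamma> (IB \<gamma> k M)}
      else
        {m. 0 < M \<and> M \<le> 1 \<and> m = mach_sub \<gamma> (IB \<gamma> k M)} \<union>
        {m. 1 < M \<and> m = mach_sup \<gamma> (IB \<gamma> k M)})"

end

theory Submission imports Defs begin

text \<open>
  The function \<open>w(M) = (M\<^sup>2 - 1) / (\<gamma> M\<^sup>2 + 1)\<close> is an increasing bijection from \<open>(0, \<infinity>)\<close> onto
  \<open>(-1, 1/\<gamma>)\<close>, with inverse \<open>v \<mapsto> sqrt ((1 + v) / (1 - \<gamma> v))\<close>, and it has the sign of \<open>M - 1\<close>.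
  The quotient (mass flux)(energy flux)/(momentum flux)\<open>\<^sup>2\<close> depends on the Mach number only and is
  proportional to \<open>1 - w(M)\<^sup>2\<close>. Hence the Mach numbers across a stationary wave are related by
  \<open>(1 + k) (1 - w(M\<^sub>-)\<^sup>2) = 1 - w(M\<^sub>+)\<^sup>2\<close>, that is \<open>w(M\<^sub>-) = \<plusminus> I\<^sup>B\<close>, and the Monotonicity
  Criterion, \<open>w(M\<^sub>-) w(M\<^sub>+) \<ge> 0\<close>, selects the sign. The critical Mach numbers express that \<open>I\<^sup>B\<close> is
  real and, on the supersonic branch, smaller than \<open>1/\<gamma>\<close>.
\<close>

section \<open>The function w and its inverse\<close>

definition mach_w :: "real \<Rightarrow> real \<Rightarrow> real" where
  "mach_w \<gamma> M = (M\<^sup>2 - 1) / (\<gamma> * M\<^sup>2 + 1)"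

lemma mach_w_denominator_pos: "\<gamma> > 1 \<Longrightarrow> \<gamma> * M\<^sup>2 + 1 > (0::real)"
  by (smt (verit) mult_nonneg_nonneg zero_le_power2)

lemma mach_w_less_iff:
  assumes "\<gamma> > 1" "M \<ge> 0" "N \<ge> 0"
  shows "mach_w \<gamma> M < mach_w \<gamma> N \<longleftrightarrow> M < N"
proof -
  have "mach_w \<gamma> M < mach_w \<gamma> N \<longleftrightarrow>
      (M\<^sup>2 - 1) * (\<gamma> * N\<^sup>2 + 1) < (N\<^sup>2 - 1) * (\<gamma> * M\<^sup>2 + 1)"
    unfolding mach_w_def
    using mach_w_denominator_pos[OF assms(1), of M] mach_w_denominator_pos[OF assms(1), of N]
    by (simp add: divide_simps)
  also have "\<dots> \<longleftrightarrow> 0 < (\<gamma> + 1) * (N\<^sup>2 - M\<^sup>2)"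
    by (simp add: algebra_simps)
  also have "\<dots> \<longleftrightarrow> M\<^sup>2 < N\<^sup>2"
    using assms(1) by (simp add: zero_less_mult_iff)
  also have "\<dots> \<longleftrightarrow> M < N"
    using assms(2,3) by (simp flip: not_le)
  finally show ?thesis .
qed

lemma mach_w_le_iff:
  assumes "\<gamma> > 1" "M \<ge> 0" "N \<ge> 0"
  shows "mach_w \<gamma> M \<le> mach_w \<gamma> N \<longleftrightarrow> M \<le> N"
  using mach_w_less_iff[OF assms(1,3,2)] by (simp flip: not_less)

lemma mach_w_1: "mach_w \<gamma> 1 = 0"
  by (simp add: mach_w_def)

lemma mach_w_gt:
  assumes "\<gamma> > 1" "M > 0"
  shows "mach_w \<gamma> M > -1"
  using mach_w_less_iff[of \<gamma> 0 M] assms by (simp add: mach_w_def)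

lemma mach_w_lt:
  assumes "\<gamma> > 1"
  shows "\<gamma> * mach_w \<gamma> M < 1"
  using mach_w_denominator_pos[OF assms, of M] assms by (simp add: mach_w_def divide_simps algebra_simps)

lemma mach_sup_pos:
  assumes "-1 < v" "\<gamma> * v < 1"
  shows "mach_sup \<gamma> v > 0"
  using assms by (simp add: mach_sup_def)

lemma mach_w_mach_sup:
  assumes "\<gamma> > 1" "-1 < v" "\<gamma> * v < 1"
  shows "mach_w \<gamma> (mach_sup \<gamma> v) = v"
proof -
  have "(mach_sup \<gamma> v)\<^sup>2 = (1 + v) / (1 - \<gamma> * v)"
    using assms by (simp add: mach_sup_def)
  then have "(mach_sup \<gamma> v)\<^sup>2 * (1 - \<gamma> * v) = 1 + v"
    using assms by simp
  then have "(mach_sup \<gamma> v)\<^sup>2 - 1 = v * (\<gamma> * (mach_sup \<gamma> v)\<^sup>2 + 1)"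
    by (simp add: algebra_simps)
  then show ?thesis
    using mach_w_denominator_pos[OF assms(1), of "mach_sup \<gamma> v"] by (simp add: mach_w_def)
qed

text \<open>Strict monotonicity of \<open>mach_w\<close> makes \<open>mach_sup\<close> give the only
  positive preimage of \<open>v\<close>. In this form the closed Mach formulas become equations for
  \<open>mach_w\<close>.\<close>

lemma mach_sup_eq_iff:
  assumes "\<gamma> > 1" "-1 < v" "\<gamma> * v < 1"
  shows "m = mach_sup \<gamma> v \<longleftrightarrow> m > 0 \<and> mach_w \<gamma> m = v"
proof
  assume "m = mach_sup \<gamma> v"
  then show "m > 0 \<and> mach_w \<gamma> m = v"
    using mach_w_mach_sup[OF assms] mach_sup_pos[OF assms(2,3)] by simp
next
  assume *: "m > 0 \<and> mach_w \<gamma> m = v"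
  then have "mach_w \<gamma> m = mach_w \<gamma> (mach_sup \<gamma> v)"
    using mach_w_mach_sup[OF assms] by simp
  then show "m = mach_sup \<gamma> v"
    using * mach_w_less_iff[OF assms(1)] mach_sup_pos[OF assms(2,3)]
    by (metis less_eq_real_def less_irrefl linorder_less_linear)
qed

text \<open>This lets one inverse function serve both the subsonic and the supersonic
  branch.\<close>

lemma mach_sub_eq_mach_sup: "mach_sub \<gamma> I = mach_sup \<gamma> (- I)"
  by (simp add: mach_sub_def mach_sup_def)

section \<open>The quantity I^B in terms of w\<close>

text \<open>The numerator is a difference of squares: (\<gamma> M^2 + 1)^2 - (M^2 - 1)^2 = (\<gamma>
  + 1) M^2 ((\<gamma> - 1) M^2 + 2). This is the term that \<open>IB\<close> divides by 1 + k and
  subtracts under the root.\<close>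

lemma one_minus_mach_w_sq:
  assumes "\<gamma> > 1"
  shows "1 - (mach_w \<gamma> M)\<^sup>2 =
    (\<gamma> + 1) * (M\<^sup>2 * ((\<gamma> - 1) * M\<^sup>2 + 2) / (\<gamma> * M\<^sup>2 + 1)\<^sup>2)"
proof -
  have "(\<gamma> * M\<^sup>2 + 1)\<^sup>2 \<noteq> 0"
    using mach_w_denominator_pos[OF assms, of M] by simp
  then show ?thesis
    unfolding mach_w_def power_divide
    by (simp add: divide_simps) (simp add: algebra_simps power2_eq_square)
qed

lemma IB_eq:
  assumes "\<gamma> > 1"
  shows "IB \<gamma> k M = sqrt (1 - (1 - (mach_w \<gamma> M)\<^sup>2) / (1 + k))"
proof -
  let ?G = "\<gamma> * M\<^sup>2 + 1"
  have G: "?G > 0"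
    using mach_w_denominator_pos[OF assms] .
  have "IB \<gamma> k M =
      sqrt ((?G\<^sup>2 - (\<gamma> + 1) * M\<^sup>2 * ((\<gamma> - 1) * M\<^sup>2 + 2) / (1 + k)) / ?G\<^sup>2)"
    using G by (simp add: IB_def real_sqrt_divide)
  also have "(?G\<^sup>2 - (\<gamma> + 1) * M\<^sup>2 * ((\<gamma> - 1) * M\<^sup>2 + 2) / (1 + k)) / ?G\<^sup>2 =
      1 - (1 - (mach_w \<gamma> M)\<^sup>2) / (1 + k)"
    unfolding one_minus_mach_w_sq[OF assms] using G by (simp add: diff_divide_distrib mult_ac)
  finally show ?thesis .
qed

text \<open>Used with a = w(M_+), b = w(M_-) and r the radicand of I^B: the sign condition selects
  the root. For a = 0 both roots survive, which is why two lines apply at M_+ = 1 when k >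
  0.\<close>

lemma sq_eq_and_same_sign_iff:
  fixes a b r :: real
  shows "a * b \<ge> 0 \<and> b\<^sup>2 = r \<longleftrightarrow>
    0 \<le> r \<and> (a \<le> 0 \<and> b = - sqrt r \<or> a \<ge> 0 \<and> b = sqrt r)"
proof
  assume *: "a * b \<ge> 0 \<and> b\<^sup>2 = r"
  then have "sqrt r = \<bar>b\<bar>" "0 \<le> r" by auto
  then show "0 \<le> r \<and> (a \<le> 0 \<and> b = - sqrt r \<or> a \<ge> 0 \<and> b = sqrt r)"
    using * by (auto simp: zero_le_mult_iff abs_if)
next
  assume "0 \<le> r \<and> (a \<le> 0 \<and> b = - sqrt r \<or> a \<ge> 0 \<and> b = sqrt r)"
  then show "a * b \<ge> 0 \<and> b\<^sup>2 = r"
    by (auto simp: mult_nonpos_nonneg)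
qed

lemma mach_w_sign:
  assumes "\<gamma> > 1" "M > 0"
  shows "mach_w \<gamma> M \<le> 0 \<longleftrightarrow> M \<le> 1" "0 \<le> mach_w \<gamma> M \<longleftrightarrow> 1 \<le> M"
    "0 < mach_w \<gamma> M \<longleftrightarrow> 1 < M"
  using mach_w_le_iff[of \<gamma> M 1] mach_w_le_iff[of \<gamma> 1 M] mach_w_less_iff[of \<gamma> 1 M] assms
  by (simp_all add: mach_w_1)

section \<open>The critical Mach numbers as preimages under w\<close>

text \<open>\<open>M1_star2\<close> is the preimage of - sqrt (- k), the subsonic point at which I^B
  vanishes; monotonicity of \<open>mach_w\<close> does the rest.\<close>

lemma le_M1_star2_iff:
  assumes "\<gamma> > 1" "-1 < k" "k < 0" "M > 0"
  shows "M \<le> M1_star2 \<gamma> k \<longleftrightarrow> mach_w \<gamma> M \<le> - sqrt (- k)"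
proof -
  have *: "-1 < - sqrt (- k)" "\<gamma> * (- sqrt (- k)) < 1"
    using assms by (auto intro: less_trans[of _ 0])
  have "M1_star2 \<gamma> k = mach_sup \<gamma> (- sqrt (- k))"
    by (simp add: M1_star2_def mach_sup_def)
  then show ?thesis
    using mach_w_le_iff[of \<gamma> M "M1_star2 \<gamma> k"] mach_w_mach_sup[OF assms(1) *] mach_sup_pos[OF *]
      assms by simp
qed

text \<open>The finite value is the preimage of sqrt (- k). The value is infinite exactly when sqrt
  (- k) reaches 1/\<gamma>, the supremum of w; then both sides are false.\<close>

lemma M2_star2_le_iff:
  assumes "\<gamma> > 1" "-1 < k" "k < 0" "M > 0"
  shows "M2_star2 \<gamma> k \<le> ereal M \<longleftrightarrow> sqrt (- k) \<le> mach_w \<gamma> M"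
proof -
  have iff: "- 1 / \<gamma>\<^sup>2 < k \<longleftrightarrow> \<gamma> * sqrt (- k) < 1"
  proof -
    have "\<gamma> * sqrt (- k) < 1 \<longleftrightarrow> sqrt (\<gamma>\<^sup>2 * (- k)) < 1"
      using assms by (simp only: real_sqrt_mult real_sqrt_abs) simp
    also have "\<dots> \<longleftrightarrow> \<gamma>\<^sup>2 * (- k) < 1" by (rule real_sqrt_lt_1_iff)
    also have "\<dots> \<longleftrightarrow> - 1 / \<gamma>\<^sup>2 < k" using assms by (simp add: field_simps)
    finally show ?thesis by simp
  qed
  show ?thesis
  proof (cases "- 1 / \<gamma>\<^sup>2 < k")
    case True
    have s: "-1 < sqrt (- k)"
      using assms by (smt (verit) real_sqrt_ge_zero)
    have t: "\<gamma> * sqrt (- k) < 1"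
      using True iff by blast
    have "M2_star2 \<gamma> k = ereal (mach_sup \<gamma> (sqrt (- k)))"
      using True by (simp add: M2_star2_def mach_sup_def)
    then show ?thesis
      using mach_w_le_iff[of \<gamma> "mach_sup \<gamma> (sqrt (- k))" M] mach_w_mach_sup[OF assms(1) s t]
        mach_sup_pos[OF s t] assms by simp
  next
    case False
    then have "1 \<le> \<gamma> * sqrt (- k)" using iff by simp
    then have "\<not> sqrt (- k) \<le> mach_w \<gamma> M"
      using mach_w_lt[OF assms(1), of M] assms(1)
      by (smt (verit) mult_left_mono)
    then show ?thesis using False by (simp add: M2_star2_def)
  qed
qed

text \<open>With s = sqrt (1 - k (\<gamma>^2 - 1)), the first case of \<open>M3_star\<close> is the
  preimage of s / \<gamma>, the point at which I^B equals 1/\<gamma>. In the other case the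
  right-hand bound is at most 0, so both sides are false for M at least 1.\<close>

lemma less_M3_star_iff:
  assumes "\<gamma> > 1" "0 < k" "1 \<le> M"
  shows "M < M3_star \<gamma> k \<longleftrightarrow> \<gamma>\<^sup>2 * (mach_w \<gamma> M)\<^sup>2 < 1 - k * (\<gamma>\<^sup>2 - 1)"
proof -
  have g: "\<gamma>\<^sup>2 - 1 > 0" using assms(1) by (simp add: one_less_power)
  have kpos: "k < 1 / (\<gamma>\<^sup>2 - 1) \<longleftrightarrow> 0 < 1 - k * (\<gamma>\<^sup>2 - 1)"
    using g by (simp add: pos_less_divide_eq)
  have w: "0 \<le> mach_w \<gamma> M" using mach_w_sign[of \<gamma> M] assms by simp
  show ?thesis
  proof (cases "k < 1 / (\<gamma>\<^sup>2 - 1)")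
    case True
    define s where "s = sqrt (1 - k * (\<gamma>\<^sup>2 - 1))"
    have s: "0 < s" "s < 1" "s\<^sup>2 = 1 - k * (\<gamma>\<^sup>2 - 1)"
      using True kpos assms(2) g by (auto simp: s_def)
    have *: "-1 < s / \<gamma>" "\<gamma> * (s / \<gamma>) < 1"
      using s assms(1) by (auto intro: less_trans[of _ 0])
    have "(\<gamma> + s) / (\<gamma> - \<gamma> * s) = (1 + s / \<gamma>) / (1 - \<gamma> * (s / \<gamma>))"
      using s assms(1) by (simp add: field_simps)
    then have "M3_star \<gamma> k = mach_sup \<gamma> (s / \<gamma>)"
      using True by (simp add: M3_star_def mach_sup_def s_def)
    then have "M < M3_star \<gamma> k \<longleftrightarrow> mach_w \<gamma> M < s / \<gamma>"
      using mach_w_less_iff[of \<gamma> M "M3_star \<gamma> k"] mach_w_mach_sup[OF assms(1) *] mach_sup_pos[OF *]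
        assms by simp
    also have "\<dots> \<longleftrightarrow> \<gamma> * mach_w \<gamma> M < s"
      using assms(1) by (simp add: pos_less_divide_eq mult.commute)
    also have "\<dots> \<longleftrightarrow> (\<gamma> * mach_w \<gamma> M)\<^sup>2 < s\<^sup>2"
      using w s(1) assms(1) by (simp flip: not_le add: power_mono_iff)
    finally show ?thesis by (simp add: s power_mult_distrib)
  next
    case False
    have "0 \<le> \<gamma>\<^sup>2 * (mach_w \<gamma> M)\<^sup>2" by simp
    moreover have "M3_star \<gamma> k = 1" using False by (simp add: M3_star_def)
    ultimately show ?thesis using False kpos assms(3) by linarith
  qed
qed

section \<open>The table of Mach numbers as one algebraic condition\<close>

lemma left_mach_values_iff:
  assumes g: "\<gamma> > 1" and k: "k > -1" and M: "M > 0"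
  shows "m \<in> left_mach_values \<gamma> k M \<longleftrightarrow>
    m > 0 \<and> mach_w \<gamma> M * mach_w \<gamma> m \<ge> 0 \<and>
    (1 + k) * (1 - (mach_w \<gamma> m)\<^sup>2) = 1 - (mach_w \<gamma> M)\<^sup>2"
proof -
  define a where "a = mach_w \<gamma> M"
  define r where "r = 1 - (1 - a\<^sup>2) / (1 + k)"
  have I: "IB \<gamma> k M = sqrt r"
    using IB_eq[OF g] by (simp add: r_def a_def)
  have a: "-1 < a" "\<gamma> * a < 1"
    using mach_w_gt[OF g M] mach_w_lt[OF g] by (auto simp: a_def)
  have "a < 1"
    using a g by (smt (verit) mult_less_cancel_right2)
  then have "a\<^sup>2 < 1"
    using a by (simp add: abs_square_less_1 abs_less_iff)
  then have "r < 1"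
    using k by (simp add: r_def)
  \<comment> \<open>I^B is real exactly when w(M_+)^2 is at least -k. This restricts M_+ only for k
    < 0.\<close>
  have r0: "0 \<le> r \<longleftrightarrow> - k \<le> a\<^sup>2"
    using k by (simp add: r_def divide_simps) linarith
  \<comment> \<open>The supersonic formula needs I^B < 1/\<gamma>, the range of w; in terms of M_+
    this is the inequality that characterizes \<open>M3_star\<close>.\<close>
  have rg: "\<gamma> * sqrt r < 1 \<longleftrightarrow> \<gamma>\<^sup>2 * a\<^sup>2 < 1 - k * (\<gamma>\<^sup>2 - 1)"
  proof -
    have "\<gamma> * sqrt r < 1 \<longleftrightarrow> sqrt (\<gamma>\<^sup>2 * r) < 1"
      using g by (simp only: real_sqrt_mult real_sqrt_abs) simp
    also have "\<dots> \<longleftrightarrow> \<gamma>\<^sup>2 * r < 1" by (rule real_sqrt_lt_1_iff)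
    also have "\<gamma>\<^sup>2 * r = \<gamma>\<^sup>2 * (k + a\<^sup>2) / (1 + k)"
      using k by (simp add: r_def field_simps)
    also have "\<dots> < 1 \<longleftrightarrow> \<gamma>\<^sup>2 * a\<^sup>2 < 1 - k * (\<gamma>\<^sup>2 - 1)"
      using k by (simp add: pos_divide_less_eq) (simp add: algebra_simps)
    finally show ?thesis .
  qed
  have eq: "(1 + k) * (1 - b\<^sup>2) = 1 - a\<^sup>2 \<longleftrightarrow> b\<^sup>2 = r" for b
    using k by (auto simp: r_def field_simps)
  have sub: "m = mach_sub \<gamma> (IB \<gamma> k M) \<longleftrightarrow> m > 0 \<and> mach_w \<gamma> m = - sqrt r" if "0 \<le> r"
  proof -
    have "0 \<le> \<gamma> * sqrt r"
      using that g by simp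
    then have "-1 < - sqrt r" "\<gamma> * (- sqrt r) < 1"
      using \<open>r < 1\<close> by simp_all
    then show ?thesis
      unfolding I mach_sub_eq_mach_sup by (rule mach_sup_eq_iff[OF g])
  qed
  have sup: "m = mach_sup \<gamma> (IB \<gamma> k M) \<longleftrightarrow> m > 0 \<and> mach_w \<gamma> m = sqrt r"
    if "0 \<le> r" "\<gamma> * sqrt r < 1"
  proof -
    have "-1 < sqrt r"
      using that by (auto intro: less_le_trans[of _ 0])
    then show ?thesis
      unfolding I using that by (intro mach_sup_eq_iff[OF g])
  qed
  \<comment> \<open>A solution on the supersonic branch brings the range bound with it. In
    \<open>rhs\<close> the bound is stated explicitly, so that \<open>sup\<close> applies in the
    converse direction.\<close>
  have small: "\<gamma> * sqrt r < 1" if "mach_w \<gamma> m = sqrt r"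
    using mach_w_lt[OF g, of m] that by simp
  have rhs: "m > 0 \<and> mach_w \<gamma> M * mach_w \<gamma> m \<ge> 0 \<and>
      (1 + k) * (1 - (mach_w \<gamma> m)\<^sup>2) = 1 - (mach_w \<gamma> M)\<^sup>2 \<longleftrightarrow>
    0 \<le> r \<and> (a \<le> 0 \<and> m = mach_sub \<gamma> (IB \<gamma> k M) \<or>
      a \<ge> 0 \<and> \<gamma> * sqrt r < 1 \<and> m = mach_sup \<gamma> (IB \<gamma> k M))"
    unfolding a_def[symmetric] eq using sq_eq_and_same_sign_iff[of a "mach_w \<gamma> m" r] sub sup small
    by blast
  have sign: "a \<le> 0 \<longleftrightarrow> M \<le> 1" "a \<ge> 0 \<longleftrightarrow> 1 \<le> M" "a > 0 \<longleftrightarrow> 1 < M"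
    using mach_w_sign[OF g M] by (simp_all add: a_def)
  consider "k > 0" | "k < 0" | "k = 0" by linarith
  then show ?thesis
  proof cases
    case 1
    have "0 \<le> r" using r0 1 by (smt (verit) zero_le_power2)
    moreover have "1 \<le> M \<Longrightarrow> M < M3_star \<gamma> k \<longleftrightarrow> \<gamma> * sqrt r < 1"
      using less_M3_star_iff[OF g 1] rg by (simp add: a_def)
    ultimately show ?thesis
      unfolding rhs sign left_mach_values_def using 1 M by auto
  next
    case 2
    \<comment> \<open>For k < 0 the bound follows from w(M_+) < 1/\<gamma>, since - k (\<gamma>^2 -
      1) only enlarges the right-hand side of \<open>rg\<close>. Hence M_+ has no upper limit
      here.\<close>
    have "\<gamma> * sqrt r < 1" if "a \<ge> 0"
    proof -
      have "(\<gamma> * a)\<^sup>2 < 1"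
        using that a g by (simp add: abs_square_less_1)
      moreover have "k * (\<gamma>\<^sup>2 - 1) \<le> 0"
        using 2 g by (simp add: mult_nonpos_nonneg)
      ultimately show ?thesis
        unfolding rg by (simp add: power_mult_distrib)
    qed
    moreover have "M \<le> M1_star2 \<gamma> k \<longleftrightarrow> a \<le> 0 \<and> 0 \<le> r"
      "M2_star2 \<gamma> k \<le> ereal M \<longleftrightarrow> a \<ge> 0 \<and> 0 \<le> r"
    proof -
      \<comment> \<open>Reality of I^B means that |a| is at least sqrt (- k) > 0. This splits into
        two disjoint ranges of \<open>a\<close>, bounded by \<open>M1_star2\<close> and
        \<open>M2_star2\<close>.\<close>
      have "0 \<le> r \<longleftrightarrow> sqrt (- k) \<le> \<bar>a\<bar>"
        unfolding r0 by (metis real_sqrt_abs real_sqrt_le_iff)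
      moreover have "0 < sqrt (- k)" using 2 by simp
      ultimately show "M \<le> M1_star2 \<gamma> k \<longleftrightarrow> a \<le> 0 \<and> 0 \<le> r"
        "M2_star2 \<gamma> k \<le> ereal M \<longleftrightarrow> a \<ge> 0 \<and> 0 \<le> r"
        using le_M1_star2_iff[OF g k 2 M] M2_star2_le_iff[OF g k 2 M]
        unfolding a_def[symmetric] by linarith+
    qed
    ultimately show ?thesis
      unfolding rhs left_mach_values_def using 2 M by auto
  next
    case 3
    then have "r = a\<^sup>2" by (simp add: r_def)
    then have r: "0 \<le> r" "a \<ge> 0 \<Longrightarrow> \<gamma> * sqrt r < 1" "a = 0 \<Longrightarrow> sqrt r = 0"
      using a by auto
    \<comment> \<open>The table for k = 0 excludes M = 1 from its second line while
      \<open>rhs\<close> includes it. There I^B = 0 and both formulas give the same value.\<close>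
    have "mach_sub \<gamma> 0 = mach_sup \<gamma> 0" by (simp add: mach_sub_eq_mach_sup)
    then have "a = 0 \<Longrightarrow> mach_sub \<gamma> (IB \<gamma> k M) = mach_sup \<gamma> (IB \<gamma> k M)"
      using r(3) I by simp
    then show ?thesis
      unfolding rhs left_mach_values_def using 3 M r(1,2) sign by auto
  qed
qed

section \<open>Mach numbers of states and the Monotonicity Criterion\<close>

text \<open>The first identity is how the Mach number enters the jump relation: it turns the
  momentum flux into p (\<gamma> M^2 + 1).\<close>

lemma state_mach:
  assumes "\<gamma> > 1" "is_state \<gamma> U"
  shows "density U * (velocity U)\<^sup>2 = \<gamma> * pressure \<gamma> U * (mach \<gamma> U)\<^sup>2"
    and "sound_speed \<gamma> U > 0"
    and "velocity U = mach \<gamma> U * sound_speed \<gamma> U"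
proof -
  have p: "density U > 0" "pressure \<gamma> U > 0"
    using assms by (auto simp: is_state_def)
  then have c: "(sound_speed \<gamma> U)\<^sup>2 = \<gamma> * pressure \<gamma> U / density U"
    using assms by (simp add: sound_speed_def)
  show s: "sound_speed \<gamma> U > 0"
    using assms p by (simp add: sound_speed_def)
  then show v: "velocity U = mach \<gamma> U * sound_speed \<gamma> U"
    by (simp add: mach_def)
  show "density U * (velocity U)\<^sup>2 = \<gamma> * pressure \<gamma> U * (mach \<gamma> U)\<^sup>2"
    unfolding v power_mult_distrib c using p by simp
qed

lemma mach_pos_iff:
  assumes "\<gamma> > 1" "is_state \<gamma> U"
  shows "mach \<gamma> U > 0 \<longleftrightarrow> velocity U > 0"
  using state_mach[OF assms] by (metis zero_less_mult_pos2 mult_pos_pos)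

text \<open>For positive velocities the second and third eigenvalues are positive, so only the first
  matters. It is (M - 1) times the sound speed and therefore has the sign of w(M).\<close>

lemma monotonicity_criterion_iff:
  assumes g: "\<gamma> > 1" and l: "is_state \<gamma> Ul" "velocity Ul > 0"
    and r: "is_state \<gamma> Ur" "velocity Ur > 0"
  shows "monotonicity_criterion \<gamma> Ul Ur \<longleftrightarrow>
    mach_w \<gamma> (mach \<gamma> Ur) * mach_w \<gamma> (mach \<gamma> Ul) \<ge> 0"
proof -
  have lam: "lambda1 \<gamma> U = (mach \<gamma> U - 1) * sound_speed \<gamma> U" if "is_state \<gamma> U" for U
    using state_mach(3)[OF g that] by (simp add: lambda1_def algebra_simps)
  have sgn: "mach_w \<gamma> M * mach_w \<gamma> m \<ge> 0 \<longleftrightarrow> (m - 1) * (M - 1) \<ge> 0" if "m > 0" "M > 0" for m M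
    using mach_w_sign[OF g that(1)] mach_w_sign[OF g that(2)] by (auto simp: zero_le_mult_iff)
  have "monotonicity_criterion \<gamma> Ul Ur \<longleftrightarrow> lambda1 \<gamma> Ul * lambda1 \<gamma> Ur \<ge> 0"
    using l(2) r(2) state_mach(2)[OF g l(1)] state_mach(2)[OF g r(1)]
    by (simp add: monotonicity_criterion_def lambda2_def lambda3_def)
  also have "lambda1 \<gamma> Ul * lambda1 \<gamma> Ur =
      (mach \<gamma> Ul - 1) * (mach \<gamma> Ur - 1) * (sound_speed \<gamma> Ul * sound_speed \<gamma> Ur)"
    using lam l r by simp
  also have "\<dots> \<ge> 0 \<longleftrightarrow> (mach \<gamma> Ul - 1) * (mach \<gamma> Ur - 1) \<ge> 0"
    using mult_pos_pos[OF state_mach(2)[OF g l(1)] state_mach(2)[OF g r(1)]]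
    by (metis mult_nonneg_nonneg less_le zero_le_mult_iff not_less)
  also have "\<dots> \<longleftrightarrow> mach_w \<gamma> (mach \<gamma> Ur) * mach_w \<gamma> (mach \<gamma> Ul) \<ge> 0"
    using sgn mach_pos_iff[OF g] l r by simp
  finally show ?thesis .
qed

section \<open>Fluxes and the jump relation\<close>

text \<open>In the product of mass and energy flux, density and velocity combine to \<rho> u^2 =
  \<gamma> p M^2, and E + p is expressed by p and M as well. Splitting off the squared momentum flux
  leaves a function of M alone, by \<open>one_minus_mach_w_sq\<close>.\<close>

lemma mass_energy_flux:
  assumes g: "\<gamma> > 1" and U: "is_state \<gamma> U"
  shows "density U * velocity U * ((energy U + pressure \<gamma> U) * velocity U) =
    \<gamma>\<^sup>2 / (2 * (\<gamma>\<^sup>2 - 1)) * (pressure \<gamma> U * (\<gamma> * (mach \<gamma> U)\<^sup>2 + 1))\<^sup>2 *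
      (1 - (mach_w \<gamma> (mach \<gamma> U))\<^sup>2)"
proof -
  define p x where "p = pressure \<gamma> U" and "x = (mach \<gamma> U)\<^sup>2"
  have G: "(\<gamma> * x + 1)\<^sup>2 \<noteq> 0"
    using mach_w_denominator_pos[OF g, of "mach \<gamma> U"] by (simp add: x_def)
  have d: "density U * (velocity U)\<^sup>2 = \<gamma> * p * x"
    using state_mach(1)[OF g U] by (simp add: p_def x_def)
  have e: "energy U + pressure \<gamma> U = \<gamma> * p / (\<gamma> - 1) + \<gamma> * p * x / 2"
    using energy_eq[of \<gamma> U] g d by (simp add: p_def field_simps)
  have "density U * velocity U * ((energy U + pressure \<gamma> U) * velocity U) =
      \<gamma> * p * x * (\<gamma> * p / (\<gamma> - 1) + \<gamma> * p * x / 2)"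
    unfolding e d[symmetric] by (simp add: power2_eq_square)
  also have "\<dots> = \<gamma>\<^sup>2 * p\<^sup>2 * x * ((\<gamma> - 1) * x + 2) / (2 * (\<gamma> - 1))"
    using g by (simp add: divide_simps power2_eq_square) (simp add: algebra_simps)
  also have "\<dots> = \<gamma>\<^sup>2 / (2 * ((\<gamma> - 1) * (\<gamma> + 1))) * (p * (\<gamma> * x + 1))\<^sup>2 *
      ((\<gamma> + 1) * (x * ((\<gamma> - 1) * x + 2) / (\<gamma> * x + 1)\<^sup>2))"
    using g G by (simp add: power_mult_distrib)
  also have "(\<gamma> - 1) * (\<gamma> + 1) = \<gamma>\<^sup>2 - 1"
    by (simp add: algebra_simps power2_eq_square)
  finally show ?thesis
    unfolding one_minus_mach_w_sq[OF g] p_def x_def .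
qed

text \<open>The three relations are translated in turn: momentum into the pressure formula, then
  mass into the density and velocity formulas, then energy into the relation between the Mach
  numbers.\<close>

lemma stationary_wave_iff:
  assumes g: "\<gamma> > 1" and k: "k1 > -1" "k2 > -1" "k3 > -1"
    and kd: "k = (1 + k1) * (1 + k3) / (1 + k2)\<^sup>2 - 1"
    and l: "is_state \<gamma> Ul" "velocity Ul > 0" and r: "is_state \<gamma> Ur" "velocity Ur > 0"
  shows "stationary_wave \<gamma> k1 k2 k3 Ul Ur \<longleftrightarrow>
    (1 + k) * (1 - (mach_w \<gamma> (mach \<gamma> Ul))\<^sup>2) = 1 - (mach_w \<gamma> (mach \<gamma> Ur))\<^sup>2 \<and>
    density Ul = density Ur * (mach \<gamma> Ur / mach \<gamma> Ul)\<^sup>2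
      * ((\<gamma> * (mach \<gamma> Ul)\<^sup>2 + 1) / (\<gamma> * (mach \<gamma> Ur)\<^sup>2 + 1))
      * ((1 + k2) / (1 + k1)\<^sup>2) \<and>
    velocity Ul = velocity Ur * (mach \<gamma> Ul / mach \<gamma> Ur)\<^sup>2
      * ((\<gamma> * (mach \<gamma> Ur)\<^sup>2 + 1) / (\<gamma> * (mach \<gamma> Ul)\<^sup>2 + 1))
      * ((1 + k1) / (1 + k2)) \<and>
    pressure \<gamma> Ul = pressure \<gamma> Ur
      * ((\<gamma> * (mach \<gamma> Ur)\<^sup>2 + 1) / (\<gamma> * (mach \<gamma> Ul)\<^sup>2 + 1))
      * (1 / (1 + k2))" (is "_ \<longleftrightarrow> ?mach \<and> ?dens \<and> ?vel \<and> ?pres")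
proof -
  define x y where "x = mach \<gamma> Ul" and "y = mach \<gamma> Ur"
  define G H where "G = \<gamma> * x\<^sup>2 + 1" and "H = \<gamma> * y\<^sup>2 + 1"
  define d u p where "d = density Ul" and "u = velocity Ul" and "p = pressure \<gamma> Ul"
  define d' u' p' where "d' = density Ur" and "u' = velocity Ur" and "p' = pressure \<gamma> Ur"
  define a b c where "a = 1 + k1" and "b = 1 + k2" and "c = 1 + k3"
  define e e' where "e = (energy Ul + pressure \<gamma> Ul) * velocity Ul"
    and "e' = (energy Ur + pressure \<gamma> Ur) * velocity Ur"
  define w w' where "w = 1 - (mach_w \<gamma> (mach \<gamma> Ul))\<^sup>2" and "w' = 1 - (mach_w \<gamma> (mach \<gamma> Ur))\<^sup>2"
  have pos: "x > 0" "y > 0" "G > 0" "H > 0" "d > 0" "u > 0" "p > 0" "d' > 0" "u' > 0" "p' > 0"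
    "a > 0" "b > 0" "c > 0"
    using mach_pos_iff[OF g] l r mach_w_denominator_pos[OF g] k
    by (auto simp: x_def y_def G_def H_def d_def u_def p_def d'_def u'_def p'_def a_def b_def c_def
        is_state_def)
  have st: "d * u\<^sup>2 = \<gamma> * p * x\<^sup>2" "d' * u'\<^sup>2 = \<gamma> * p' * y\<^sup>2"
    using state_mach(1)[OF g] l r by (auto simp: x_def y_def d_def u_def p_def d'_def u'_def p'_def)
  have mom: "(d * u\<^sup>2 + p) * b = d' * u'\<^sup>2 + p' \<longleftrightarrow> p * G * b = p' * H"
    unfolding st G_def H_def by (simp add: algebra_simps)
  have pres: "?pres \<longleftrightarrow> p * G * b = p' * H"
    unfolding x_def[symmetric] y_def[symmetric] p_def[symmetric] p'_def[symmetric]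
      G_def[symmetric] H_def[symmetric] b_def[symmetric]
    using pos by (auto simp: divide_simps mult_ac)
  have vel: "?vel \<longleftrightarrow> u = u' * (x / y)\<^sup>2 * (H / G) * (a / b)"
    unfolding x_def y_def u_def u'_def G_def H_def a_def b_def ..
  have dens: "?dens \<longleftrightarrow> d = d' * (y / x)\<^sup>2 * (G / H) * (b / a\<^sup>2)"
    unfolding x_def y_def d_def d'_def G_def H_def a_def b_def ..
  have mass: "d * u * a = d' * u' \<longleftrightarrow> ?dens \<and> ?vel" if P: "p * G * b = p' * H"
  proof
    assume m: "d * u * a = d' * u'"
    \<comment> \<open>The mass flux equals \<gamma> p M^2 / u on either side, so the mass relation
      links the two velocities without the densities. The computation is the division-free form of
      this.\<close>
    have "u * (d' * u') * (\<gamma> * p' * y\<^sup>2) = (d * u\<^sup>2) * a * (d' * u'\<^sup>2)"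
      unfolding m[symmetric] st(2)[symmetric] by (simp add: power2_eq_square)
    also have "\<dots> = \<gamma> * p * x\<^sup>2 * a * (d' * u'\<^sup>2)" using st by simp
    finally have "(d' * u' * \<gamma>) * (u * p' * y\<^sup>2) = (d' * u' * \<gamma>) * (p * x\<^sup>2 * a * u')"
      by (simp add: power2_eq_square mult_ac)
    then have up: "u * p' * y\<^sup>2 = p * x\<^sup>2 * a * u'"
      using pos g by (simp only: mult_cancel_left) auto
    have p: "p = p' * H / (G * b)" using P pos by (simp add: field_simps)
    have "p' * (u * y\<^sup>2) = p' * (H / (G * b) * x\<^sup>2 * a * u')"
      using up unfolding p by (simp add: mult_ac)
    then have "u * y\<^sup>2 = H / (G * b) * x\<^sup>2 * a * u'"
      using pos by (simp only: mult_cancel_left) auto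
    then have v: "u = u' * (x / y)\<^sup>2 * (H / G) * (a / b)"
      using pos by (simp add: field_simps)
    have "d = d' * u' / (u * a)" using m pos by (simp add: field_simps)
    also have "\<dots> = d' * (y / x)\<^sup>2 * (G / H) * (b / a\<^sup>2)"
      unfolding v using pos by (simp add: divide_simps power2_eq_square)
    finally show "?dens \<and> ?vel" using v vel dens by blast
  next
    assume "?dens \<and> ?vel"
    then have "d * u * a = d' * (y / x)\<^sup>2 * (G / H) * (b / a\<^sup>2) * (u' * (x / y)\<^sup>2 * (H / G) * (a / b)) * a"
      using vel dens by metis
    also have "\<dots> = d' * u'"
      using pos by (simp add: divide_simps power2_eq_square)
    finally show "d * u * a = d' * u'" .
  qed
  have en: "e * c = e' \<longleftrightarrow> (1 + k) * w = w'" if P: "p * G * b = p' * H" and m: "d * u * a = d' * u'"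
  proof -
    define C where "C = \<gamma>\<^sup>2 / (2 * (\<gamma>\<^sup>2 - 1))"
    have C: "C > 0" using g by (simp add: C_def one_less_power)
    have f: "d * u * e = C * (p * G)\<^sup>2 * w" "d' * u' * e' = C * (p' * H)\<^sup>2 * w'"
      using mass_energy_flux[OF g] l r
      by (auto simp: d_def u_def e_def C_def p_def G_def w_def x_def
          d'_def u'_def e'_def p'_def H_def w'_def y_def)
    \<comment> \<open>The energy relation is multiplied by the mass flux so that
      \<open>mass_energy_flux\<close> applies. The coefficients combine to a c = (1 + k) b^2, and
      the momentum relation absorbs b^2.\<close>
    have "e * c = e' \<longleftrightarrow> (d' * u') * (e * c) = (d' * u') * e'"
      using pos by simp
    also have "(d' * u') * (e * c) = (d * u * e) * (a * c)"
      unfolding m[symmetric] by (simp add: mult_ac)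
    also have "a * c = (1 + k) * b\<^sup>2"
      using pos by (simp add: kd a_def b_def c_def)
    also have "(d * u * e) * ((1 + k) * b\<^sup>2) = C * (p * G * b)\<^sup>2 * ((1 + k) * w)"
      unfolding f by (simp add: power_mult_distrib mult_ac)
    also have "\<dots> = C * (p' * H)\<^sup>2 * ((1 + k) * w)"
      unfolding P ..
    also have "\<dots> = d' * u' * e' \<longleftrightarrow> (1 + k) * w = w'"
      unfolding f using C pos by simp
    finally show ?thesis .
  qed
  have "stationary_wave \<gamma> k1 k2 k3 Ul Ur \<longleftrightarrow>
      d * u * a = d' * u' \<and> (d * u\<^sup>2 + p) * b = d' * u'\<^sup>2 + p' \<and> e * c = e'"
    using l r by (simp add: stationary_wave_def d_def u_def p_def d'_def u'_def p'_def
        a_def b_def c_def e_def e'_def)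
  also have "\<dots> \<longleftrightarrow> (1 + k) * w = w' \<and> ?dens \<and> ?vel \<and> ?pres"
    unfolding mom pres using mass en by blast
  finally show ?thesis
    unfolding w_def w'_def .
qed

section \<open>Realization of the admissible Mach numbers and the final characterization\<close>

text \<open>Conserved variables are computed from the primitive ones. The compatibility condition
  determines the squared Mach number, and u > 0 its sign.\<close>

lemma exists_state:
  assumes "\<gamma> > 1" "d > 0" "p > 0" "m > 0" "d * u\<^sup>2 = \<gamma> * p * m\<^sup>2" "u > 0"
  obtains U where "is_state \<gamma> U" "density U = d" "velocity U = u" "pressure \<gamma> U = p" "mach \<gamma> U = m"
proof
  define U where "U = Euler_State d (d * u) (p / (\<gamma> - 1) + 1/2 * d * u\<^sup>2)"
  show d: "density U = d" by (simp add: U_def)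
  show u: "velocity U = u" using assms by (simp add: U_def velocity_def)
  show p: "pressure \<gamma> U = p" using assms u by (simp add: pressure_def) (simp add: U_def)
  show s: "is_state \<gamma> U" using d p assms by (simp add: is_state_def)
  have "\<gamma> * p * (mach \<gamma> U)\<^sup>2 = \<gamma> * p * m\<^sup>2"
    using state_mach(1)[OF assms(1) s] unfolding d u p assms(5) ..
  then have "(mach \<gamma> U)\<^sup>2 = m\<^sup>2" using assms by (simp only: mult_cancel_left) auto
  moreover have "mach \<gamma> U > 0" using mach_pos_iff[OF assms(1) s] u assms by simp
  ultimately show "mach \<gamma> U = m" using assms(4) by (simp add: power2_eq_iff_nonneg)
qed

text \<open>The formulas refer to the Mach number of \<open>Ul\<close> itself, so the set equality
  alone does not say that every listed value occurs. The second conjunct asserts that each one is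
  attained.\<close>

theorem proposition2p3:
  fixes \<gamma> k1 k2 k3 k :: real and Ur :: euler_state
  assumes "\<gamma> > 1"
    and "k1 > -1" and "k2 > -1" and "k3 > -1"
    and "k = (1 + k1) * (1 + k3) / (1 + k2)\<^sup>2 - 1"
    and "is_state \<gamma> Ur" and "velocity Ur > 0"
  shows "DB \<gamma> Ur k1 k2 k3 =
      {Ul. is_state \<gamma> Ul \<and>
           mach \<gamma> Ul \<in> left_mach_values \<gamma> k (mach \<gamma> Ur) \<and>
           density Ul = density Ur * (mach \<gamma> Ur / mach \<gamma> Ul)\<^sup>2
             * ((\<gamma> * (mach \<gamma> Ul)\<^sup>2 + 1) / (\<gamma> * (mach \<gamma> Ur)\<^sup>2 + 1))
             * ((1 + k2) / (1 + k1)\<^sup>2) \<and>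
           velocity Ul = velocity Ur * (mach \<gamma> Ul / mach \<gamma> Ur)\<^sup>2
             * ((\<gamma> * (mach \<gamma> Ur)\<^sup>2 + 1) / (\<gamma> * (mach \<gamma> Ul)\<^sup>2 + 1))
             * ((1 + k1) / (1 + k2)) \<and>
           pressure \<gamma> Ul = pressure \<gamma> Ur
             * ((\<gamma> * (mach \<gamma> Ur)\<^sup>2 + 1) / (\<gamma> * (mach \<gamma> Ul)\<^sup>2 + 1))
             * (1 / (1 + k2))}
    \<and> mach \<gamma> ` DB \<gamma> Ur k1 k2 k3 = left_mach_values \<gamma> k (mach \<gamma> Ur)"
    (is "_ = ?S \<and> _")
proof -
  have M: "mach \<gamma> Ur > 0"
    using mach_pos_iff assms by blast
  have k: "k > -1"
    using assms by simp
  note values_iff = left_mach_values_iff[OF assms(1) k M]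
  have vel: "velocity U > 0" if "is_state \<gamma> U" "mach \<gamma> U \<in> left_mach_values \<gamma> k (mach \<gamma> Ur)" for U
    using mach_pos_iff[OF assms(1) that(1)] that(2) values_iff by blast
  have state: "is_state \<gamma> U \<and> velocity U > 0" if "U \<in> DB \<gamma> Ur k1 k2 k3" for U
    using that by (simp add: DB_def stationary_wave_def)
  have iff: "U \<in> DB \<gamma> Ur k1 k2 k3 \<longleftrightarrow> U \<in> ?S" if U: "is_state \<gamma> U" "velocity U > 0" for U
  proof -
    have "mach \<gamma> U > 0"
      using mach_pos_iff[OF assms(1)] U by blast
    then show ?thesis
      using U
      unfolding DB_def mem_Collect_eq stationary_wave_iff[OF assms(1-5) U assms(6,7)] values_iff
        monotonicity_criterion_iff[OF assms(1) U assms(6,7)]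
      by blast
  qed
  \<comment> \<open>Both sets contain only states of positive velocity, the ones covered by
    \<open>iff\<close>.\<close>
  have eq: "DB \<gamma> Ur k1 k2 k3 = ?S"
    using iff state vel by blast
  have "m \<in> mach \<gamma> ` ?S" if m: "m \<in> left_mach_values \<gamma> k (mach \<gamma> Ur)" for m
  proof -
    define M d u p where "M = mach \<gamma> Ur" and "d = density Ur" and "u = velocity Ur"
      and "p = pressure \<gamma> Ur"
    define G H where "G = \<gamma> * m\<^sup>2 + 1" and "H = \<gamma> * M\<^sup>2 + 1"
    define a b where "a = 1 + k1" and "b = 1 + k2"
    have pos: "m > 0" "M > 0" "d > 0" "u > 0" "p > 0" "G > 0" "H > 0" "a > 0" "b > 0"
      using m values_iff M assms mach_w_denominator_pos[OF assms(1)]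
      by (auto simp: M_def d_def u_def p_def G_def H_def a_def b_def is_state_def)
    have st: "d * u\<^sup>2 = \<gamma> * p * M\<^sup>2"
      using state_mach(1)[OF assms(1,6)] by (simp add: M_def d_def u_def p_def)
    let ?d = "d * (M / m)\<^sup>2 * (G / H) * (b / a\<^sup>2)"
    let ?u = "u * (m / M)\<^sup>2 * (H / G) * (a / b)"
    let ?p = "p * (H / G) * (1 / b)"
    \<comment> \<open>The prescribed density, velocity and pressure satisfy the compatibility
      condition of \<open>exists_state\<close> for \<open>m\<close>, so the state built from them
      has Mach number \<open>m\<close>.\<close>
    have "?d * ?u\<^sup>2 = d * u\<^sup>2 * ((m / M)\<^sup>2 * (H / G) * (1 / b))"
      using pos by (simp add: divide_simps power2_eq_square)
    also have "\<dots> = \<gamma> * ?p * m\<^sup>2"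
      unfolding st using pos by (simp add: divide_simps power2_eq_square)
    finally have "?d * ?u\<^sup>2 = \<gamma> * ?p * m\<^sup>2" .
    moreover have "?d > 0" "?p > 0" "?u > 0"
      using pos by simp_all
    ultimately obtain U where "is_state \<gamma> U" "density U = ?d" "velocity U = ?u"
      "pressure \<gamma> U = ?p" "mach \<gamma> U = m"
      using exists_state[OF assms(1) _ _ pos(1)] by metis
    then have "U \<in> ?S" "m = mach \<gamma> U"
      using m by (simp_all add: M_def d_def u_def p_def G_def H_def a_def b_def)
    then show ?thesis by blast
  qed
  then have "mach \<gamma> ` ?S = left_mach_values \<gamma> k (mach \<gamma> Ur)"
    by blast
  then show ?thesis
    unfolding eq by simp
qed

end
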